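(* Suppose that for every follower $i\in\{1,\dots,n\}$ the maps $y_i\mapsto\theta_i(x,y_i,y_{-i})$ and $y_i\mapsto g_{i,j}(x,y_i)$ ($j=1,\dots,p_i$) are convex (for all values of the remaining variables), and that for every follower $i$ Slater's constraint qualification is satisfied at every $x\in X$. Let $(\bar x,\bar y,\bar\mu)$ be a global solution of the MPCC reformulation (MPCC). Then $(\bar x,\bar y)$ is a global solution of the single-leader multi-follower game (SLMFG).
   Context: Setting. There is one leader with decision variable $x\in\mathbb{R}^{n_0}$, restricted to a set $X\subset\mathbb{R}^{n_0}$, and with objective $\theta_0:\mathbb{R}^{n_0}\times\prod_{i=1}^n\mathbb{R}^{n_i}\to\mathbb{R}$. There are $n$ followers; follower $i$ has decision variable $y_i\in\mathbb{R}^{n_i}$. Write $y=(y_1,\dots,y_n)=(y_i,y_{-i})$, where $y_{-i}$ collects the decisions of the followers other than $i$. Follower $i$ has objective $\theta_i(x,y_i,y_{-i})\in\mathbb{R}$ and constraint functions $g_{i,j}:\mathbb{R}^{n_0}\times\mathbb{R}^{n_i}\to\mathbb{R}$, $j=1,\dots,p_i$, with feasible set $Y_i(x)=\{y_i : g_{i,j}(x,y_i)\le 0\ \forall j\}$. Write $g_i=(g_{i,1},\dots,g_{i,p_i})$. Standing smoothness assumption: $y_i\mapsto\theta_i(x,y_i,y_{-i})$ and $y_i\mapsto g_{i,j}(x,y_i)$ are continuously differentiable, and the gradients $\nabla_{y_i}\theta_i(x,y_i,y_{-i})$ and $\nabla_{y_i}g_{i,j}(x,y_i)$ are continuous in all of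 their variables. Nash equilibria. $\mathrm{NEP}(x)$ is the set of $y$ such that, for every $i$, $y_i$ minimizes $\theta_i(x,\cdot,y_{-i})$ over $Y_i(x)$. (SLMFG): minimize $\theta_0(x,y)$ over $(x,y)$ subject to $x\in X$ and $y\in\mathrm{NEP}(x)$. (MPCC): minimize $\theta_0(x,y)$ over $(x,y,\mu)$ with $\mu=(\mu_1,\dots,\mu_n)$, $\mu_i\in\mathbb{R}^{p_i}$, subject to $x\in X$ and, for every $i$, $$\nabla_{y_i}\theta_i(x,y_i,y_{-i})+\sum_{j=1}^{p_i}\mu_{i,j}\nabla_{y_i}g_{i,j}(x,y_i)=0,\quad g_i(x,y_i)\le 0,\quad \mu_i\ge 0,\quad \langle\mu_i,g_i(x,y_i)\rangle=0.$$ Slater's constraint qualification for follower $i$ at $x$: there is $y_i\in\mathbb{R}^{n_i}$ with $g_{i,j}(x,y_i)<0$ for all $j=1,\dots,p_i$. A global solution of a problem is a feasible point minimizing the objective over all feasible points. *)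

theory Defs
  imports "HOL-Analysis.Analysis"
begin

text \<open>
  The followers are the elements of a finite type \<open>'f\<close>. Their decision spaces may have different
  dimensions, so the space of follower \<open>i\<close> is the coordinate subspace \<open>coord_space (N i)\<close> of a
  common \<open>real ^ 'm\<close>: a copy of \<open>\<real>\<close> to the power \<open>card (N i)\<close>. Since \<open>'m\<close> and \<open>N\<close> are arbitrary,
  every family of dimensions arises. Functions of a follower's decision are total on \<open>real ^ 'm\<close>,
  but all the notions below depend only on their values on the coordinate subspaces.
\<close>

definition coord_space :: "'m set \<Rightarrow> (real ^ 'm) set" where
  "coord_space N = {v. \<forall>k. k \<notin> N \<longrightarrow> v $ k = 0}"

definition profiles :: "('f \<Rightarrow> 'm set) \<Rightarrow> (real ^ 'm ^ 'f) set" where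
  "profiles N = {y. \<forall>i. y $ i \<in> coord_space (N i)}"

text \<open>\<open>replace_decision y i z\<close> is the profile \<open>(z, y\<^sub>-\<^sub>i)\<close>.\<close>

definition replace_decision :: "real ^ 'm ^ 'f \<Rightarrow> 'f \<Rightarrow> real ^ 'm \<Rightarrow> real ^ 'm ^ 'f" where
  "replace_decision y i z = (\<chi> l. if l = i then z else y $ l)"

text \<open>
  The gradient at \<open>z\<close> of a function on the subspace \<open>V\<close>, as an element of \<open>V\<close>. For \<open>V = UNIV\<close> this
  is the library's \<open>GDERIV\<close>. It is only meaningful where a gradient exists.
\<close>

definition has_gradient_in ::
    "('a::real_inner \<Rightarrow> real) \<Rightarrow> 'a \<Rightarrow> 'a set \<Rightarrow> 'a \<Rightarrow> bool" where
  "has_gradient_in f D V z \<longleftrightarrow> D \<in> V \<and> (f has_derivative (\<lambda>h. h \<bullet> D)) (at z within V)"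

definition gradient :: "'a::real_inner set \<Rightarrow> ('a \<Rightarrow> real) \<Rightarrow> 'a \<Rightarrow> 'a" where
  "gradient V f z = (THE D. has_gradient_in f D V z)"

lemma subspace_coord_space: "subspace (coord_space N)"
  by (auto simp: coord_space_def subspace_def)

lemma has_gradient_in_UNIV: "has_gradient_in f D UNIV z \<longleftrightarrow> GDERIV f z :> D"
  by (simp add: has_gradient_in_def gderiv_def)

lemma has_gradient_in_unique:
  assumes V: "subspace V" "z \<in> V"
    and D: "has_gradient_in f D V z" and D': "has_gradient_in f D' V z"
  shows "D = D'"
proof -
  let ?d = "D - D'"
  have dV: "?d \<in> V"
    using V D D' by (simp add: has_gradient_in_def subspace_diff)
  have path: "((\<lambda>t::real. z + t *\<^sub>R ?d) has_derivative (\<lambda>t. t *\<^sub>R ?d)) (at 0)"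
    by (auto intro!: derivative_eq_intros)
  have img: "range (\<lambda>t::real. z + t *\<^sub>R ?d) \<subseteq> V"
    using V dV by (auto intro: subspace_add subspace_scale)
  have along: "((\<lambda>t. f (z + t *\<^sub>R ?d)) has_derivative (\<lambda>t. (t *\<^sub>R ?d) \<bullet> E)) (at 0)"
    if "has_gradient_in f E V z" for E
  proof (rule has_derivative_in_compose[OF path])
    show "(f has_derivative (\<lambda>h. h \<bullet> E)) (at (z + 0 *\<^sub>R ?d) within range (\<lambda>t::real. z + t *\<^sub>R ?d))"
      using that img by (auto simp: has_gradient_in_def intro: has_derivative_subset)
  qed
  have "(\<lambda>t::real. (t *\<^sub>R ?d) \<bullet> D) = (\<lambda>t. (t *\<^sub>R ?d) \<bullet> D')"
    by (rule has_derivative_unique[OF along[OF D] along[OF D']])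
  from fun_cong[OF this, of 1] have "?d \<bullet> ?d = 0"
    by (simp add: inner_diff_right)
  then show ?thesis by simp
qed

lemma gradient_eq:
  assumes "subspace V" "z \<in> V" "has_gradient_in f D V z"
  shows "gradient V f z = D"
  unfolding gradient_def using assms has_gradient_in_unique by (intro the_equality) blast+

lemma has_gradient_in_coord_space:
  fixes z :: "real ^ 'm"
  assumes f: "f differentiable (at z within coord_space N)" and z: "z \<in> coord_space N"
  shows "has_gradient_in f (gradient (coord_space N) f z) (coord_space N) z"
proof -
  let ?V = "coord_space N"
  obtain f' where f': "(f has_derivative f') (at z within ?V)"
    using f by (auto simp: differentiable_def)
  then interpret f': bounded_linear f' by (rule has_derivative_bounded_linear)
  define D :: "real ^ 'm" where "D = (\<chi> k. if k \<in> N then f' (axis k 1) else 0)"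
  have on_V: "f' h = h \<bullet> D" if "h \<in> ?V" for h
  proof -
    have "f' h = f' (\<Sum>k\<in>UNIV. (h $ k) *\<^sub>R axis k 1)"
      using basis_expansion[of h] by (simp add: scalar_mult_eq_scaleR)
    also have "\<dots> = (\<Sum>k\<in>UNIV. h $ k * f' (axis k 1))"
      by (simp add: f'.sum f'.scaleR)
    also have "\<dots> = h \<bullet> D"
      using that by (auto simp: inner_vec_def D_def coord_space_def intro!: sum.cong)
    finally show ?thesis .
  qed
  have "(f has_derivative (\<lambda>h. h \<bullet> D)) (at z within ?V)"
    unfolding has_derivative_within
  proof (intro conjI)
    show "bounded_linear (\<lambda>h. h \<bullet> D)" by (rule bounded_linear_inner_left)
    have "((\<lambda>y. (1 / norm (y - z)) *\<^sub>R (f y - (f z + f' (y - z)))) \<longlongrightarrow> 0) (at z within ?V)"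
      using f' by (simp add: has_derivative_within)
    moreover have "\<forall>\<^sub>F y in at z within ?V. f' (y - z) = (y - z) \<bullet> D"
      using on_V z by (auto simp: eventually_at_filter subspace_diff[OF subspace_coord_space])
    ultimately show "((\<lambda>y. (1 / norm (y - z)) *\<^sub>R (f y - (f z + (y - z) \<bullet> D))) \<longlongrightarrow> 0)
        (at z within ?V)"
      by (auto elim!: Lim_transform_eventually eventually_mono)
  qed
  then have "has_gradient_in f D ?V z"
    by (simp add: has_gradient_in_def D_def coord_space_def)
  then show ?thesis
    using gradient_eq[OF subspace_coord_space z] by simp
qed

text \<open>
  Follower \<open>i\<close> has \<open>p i\<close> constraint functions \<open>g i 1, \<dots>, g i (p i)\<close>. Its objective \<open>\<theta> i\<close> takes the
  leader's decision and the whole profile.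
\<close>

definition feasible_set ::
    "('f \<Rightarrow> 'm set) \<Rightarrow> ('f \<Rightarrow> nat) \<Rightarrow> ('f \<Rightarrow> nat \<Rightarrow> 'x \<Rightarrow> real ^ 'm \<Rightarrow> real) \<Rightarrow> 'f \<Rightarrow> 'x \<Rightarrow> (real ^ 'm) set"
  where
  "feasible_set N p g i x = {z \<in> coord_space (N i). \<forall>j\<in>{1..p i}. g i j x z \<le> 0}"

definition NEP ::
    "('f \<Rightarrow> 'm set) \<Rightarrow> ('f \<Rightarrow> nat) \<Rightarrow> ('f \<Rightarrow> 'x \<Rightarrow> real ^ 'm ^ 'f \<Rightarrow> real) \<Rightarrow>
     ('f \<Rightarrow> nat \<Rightarrow> 'x \<Rightarrow> real ^ 'm \<Rightarrow> real) \<Rightarrow> 'x \<Rightarrow> (real ^ 'm ^ 'f) set" where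
  "NEP N p \<theta> g x = {y \<in> profiles N. \<forall>i.
     is_arg_min (\<lambda>z. \<theta> i x (replace_decision y i z)) (\<lambda>z. z \<in> feasible_set N p g i x) (y $ i)}"

definition slater ::
    "('f \<Rightarrow> 'm set) \<Rightarrow> ('f \<Rightarrow> nat) \<Rightarrow> ('f \<Rightarrow> nat \<Rightarrow> 'x \<Rightarrow> real ^ 'm \<Rightarrow> real) \<Rightarrow> 'f \<Rightarrow> 'x \<Rightarrow> bool" where
  "slater N p g i x \<longleftrightarrow> (\<exists>z\<in>coord_space (N i). \<forall>j\<in>{1..p i}. g i j x z < 0)"

definition SLMFG_feasible ::
    "'x set \<Rightarrow> ('f \<Rightarrow> 'm set) \<Rightarrow> ('f \<Rightarrow> nat) \<Rightarrow> ('f \<Rightarrow> 'x \<Rightarrow> real ^ 'm ^ 'f \<Rightarrow> real) \<Rightarrow>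
     ('f \<Rightarrow> nat \<Rightarrow> 'x \<Rightarrow> real ^ 'm \<Rightarrow> real) \<Rightarrow> ('x \<times> (real ^ 'm ^ 'f)) set" where
  "SLMFG_feasible X N p \<theta> g = {(x, y). x \<in> X \<and> y \<in> NEP N p \<theta> g x}"

definition SLMFG_global_solution where
  "SLMFG_global_solution \<theta>\<^sub>0 X N p \<theta> g x y \<longleftrightarrow>
     is_arg_min (\<lambda>(x, y). \<theta>\<^sub>0 x y :: real) (\<lambda>s. s \<in> SLMFG_feasible X N p \<theta> g) (x, y)"

text \<open>
  The multiplier vector of follower \<open>i\<close> is a function on \<open>{1..p i}\<close>, extended by \<open>undefined\<close>.
\<close>

definition MPCC_feasible ::
    "'x set \<Rightarrow> ('f \<Rightarrow> 'm set) \<Rightarrow> ('f \<Rightarrow> nat) \<Rightarrow> ('f \<Rightarrow> 'x \<Rightarrow> real ^ 'm ^ 'f \<Rightarrow> real) \<Rightarrow>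
     ('f \<Rightarrow> nat \<Rightarrow> 'x \<Rightarrow> real ^ 'm \<Rightarrow> real) \<Rightarrow>
     ('x \<times> (real ^ 'm ^ 'f) \<times> ('f \<Rightarrow> nat \<Rightarrow> real)) set" where
  "MPCC_feasible X N p \<theta> g = {(x, y, \<mu>). x \<in> X \<and> y \<in> profiles N \<and> (\<forall>i.
     \<mu> i \<in> {1..p i} \<rightarrow>\<^sub>E UNIV \<and>
     gradient (coord_space (N i)) (\<lambda>z. \<theta> i x (replace_decision y i z)) (y $ i)
       + (\<Sum>j=1..p i. \<mu> i j *\<^sub>R gradient (coord_space (N i)) (g i j x) (y $ i)) = 0 \<and>
     (\<forall>j\<in>{1..p i}. g i j x (y $ i) \<le> 0) \<and>
     (\<forall>j\<in>{1..p i}. \<mu> i j \<ge> 0) \<and>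
     (\<Sum>j=1..p i. \<mu> i j * g i j x (y $ i)) = 0)}"

definition MPCC_global_solution where
  "MPCC_global_solution \<theta>\<^sub>0 X N p \<theta> g x y \<mu> \<longleftrightarrow>
     is_arg_min (\<lambda>(x, y, \<mu>). \<theta>\<^sub>0 x y :: real) (\<lambda>s. s \<in> MPCC_feasible X N p \<theta> g) (x, y, \<mu>)"

text \<open>
  Joint continuity of the gradients includes continuity in the follower's own decision, so it makes
  the differentiable functions below continuously differentiable in that decision.
\<close>

definition smooth_objective ::
    "('f \<Rightarrow> 'm set) \<Rightarrow> ('f \<Rightarrow> 'x::topological_space \<Rightarrow> real ^ 'm ^ 'f \<Rightarrow> real) \<Rightarrow> 'f \<Rightarrow> bool" where
  "smooth_objective N \<theta> i \<longleftrightarrow>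
     (\<forall>x. \<forall>y\<in>profiles N.
        (\<lambda>z. \<theta> i x (replace_decision y i z)) differentiable_on coord_space (N i)) \<and>
     continuous_on (UNIV \<times> profiles N)
       (\<lambda>(x, y). gradient (coord_space (N i)) (\<lambda>z. \<theta> i x (replace_decision y i z)) (y $ i))"

definition smooth_constraint ::
    "('f \<Rightarrow> 'm set) \<Rightarrow> ('f \<Rightarrow> nat \<Rightarrow> 'x::topological_space \<Rightarrow> real ^ 'm \<Rightarrow> real) \<Rightarrow> 'f \<Rightarrow> nat \<Rightarrow> bool"
  where
  "smooth_constraint N g i j \<longleftrightarrow>
     (\<forall>x. g i j x differentiable_on coord_space (N i)) \<and>
     continuous_on (UNIV \<times> coord_space (N i))
       (\<lambda>(x, z). gradient (coord_space (N i)) (g i j x) z)"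

end

theory Submission
  imports Defs
begin

text \<open>
  For \<open>x \<in> X\<close> the followers' problems are smooth convex programs satisfying Slater's condition, so a
  feasible point of such a program is optimal exactly when it carries Karush-Kuhn-Tucker
  multipliers. Hence \<open>y\<close> is an equilibrium for \<open>x\<close> iff some \<open>\<mu>\<close> makes \<open>(x, y, \<mu>)\<close> feasible for the
  complementarity problem (\<open>NEP_iff_MPCC_feasible\<close>). The feasible set of the game is thus the
  projection of that of the complementarity problem, and as the leader's objective ignores \<open>\<mu>\<close>,
  global minimizers project to global minimizers.

  Multipliers suffice because the Lagrangian is convex and stationary, hence minimal, at the point
  (\<open>KKT_sufficient\<close>). They exist by a theorem of the alternative (\<open>gordan_alternative\<close>): a minimizer
  admits no direction that strictly decreases the objective and all active constraints to first
  order, so some convex combination of their gradients vanishes. The direction towards a Slater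
  point strictly decreases every active constraint, so the objective has positive weight in this
  combination and can be normalized to weight \<open>1\<close> (\<open>KKT_necessary\<close>).
\<close>

section \<open>Gradients and directional derivatives\<close>

lemma has_gradient_in_directional:
  assumes V: "subspace V" "z \<in> V" "d \<in> V" and D: "has_gradient_in f D V z"
  shows "((\<lambda>t. f (z + t *\<^sub>R d)) has_real_derivative d \<bullet> D) (at 0)"
proof -
  have path: "((\<lambda>t::real. z + t *\<^sub>R d) has_derivative (\<lambda>t. t *\<^sub>R d)) (at 0)"
    by (auto intro!: derivative_eq_intros)
  have img: "range (\<lambda>t::real. z + t *\<^sub>R d) \<subseteq> V"
    using V by (auto intro: subspace_add subspace_scale)
  have "((\<lambda>t. f (z + t *\<^sub>R d)) has_derivative (\<lambda>t. (t *\<^sub>R d) \<bullet> D)) (at 0)"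
  proof (rule has_derivative_in_compose[OF path])
    show "(f has_derivative (\<lambda>h. h \<bullet> D)) (at (z + 0 *\<^sub>R d) within range (\<lambda>t::real. z + t *\<^sub>R d))"
      using D img by (auto simp: has_gradient_in_def intro: has_derivative_subset)
  qed
  then show ?thesis
    by (simp add: has_field_derivative_def mult_commute_abs)
qed

lemma convex_on_above_tangent:
  assumes V: "subspace V" "z \<in> V" "w \<in> V" and f: "convex_on V f" and D: "has_gradient_in f D V z"
  shows "f z + (w - z) \<bullet> D \<le> f w"
proof (rule ccontr)
  assume "\<not> ?thesis"
  then have pos: "(w - z) \<bullet> D - (f w - f z) > 0" by simp
  have "((\<lambda>t. f (z + t *\<^sub>R (w - z))) has_real_derivative (w - z) \<bullet> D) (at 0)"
    using V D by (intro has_gradient_in_directional) (auto intro: subspace_diff)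
  then have "((\<lambda>t. f (z + t *\<^sub>R (w - z)) - t * (f w - f z)) has_real_derivative
      (w - z) \<bullet> D - (f w - f z)) (at 0)"
    by (auto intro!: derivative_eq_intros)
  from DERIV_pos_inc_right[OF this pos] obtain e where "e > 0"
    and e: "\<And>t. 0 < t \<Longrightarrow> t < e \<Longrightarrow> f z < f (z + t *\<^sub>R (w - z)) - t * (f w - f z)"
    by auto
  \<comment> \<open>Just after \<open>z\<close> the graph rises above its chord, against convexity.\<close>
  define t where "t = min (e / 2) 1"
  have t: "0 < t" "t < e" "t \<le> 1" using \<open>e > 0\<close> by (auto simp: t_def)
  have "f ((1 - t) *\<^sub>R z + t *\<^sub>R w) \<le> (1 - t) * f z + t * f w"
    using f V t by (intro convex_onD) auto
  moreover have "(1 - t) *\<^sub>R z + t *\<^sub>R w = z + t *\<^sub>R (w - z)"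
    by (simp add: algebra_simps)
  ultimately show False
    using e[OF t(1,2)] by (simp add: algebra_simps)
qed

section \<open>A theorem of the alternative\<close>

text \<open>
  The convex hull of the vectors is compact. If it misses the origin, its point closest to the
  origin makes a positive inner product with all of them. Otherwise the origin is itself a convex
  combination of the vectors.
\<close>

lemma gordan_alternative:
  fixes v :: "'i \<Rightarrow> 'a::euclidean_space"
  assumes V: "subspace V" and I: "finite I" "I \<noteq> {}" and v: "\<And>i. i \<in> I \<Longrightarrow> v i \<in> V"
  shows "(\<exists>d\<in>V. \<forall>i\<in>I. 0 < d \<bullet> v i) \<or>
    (\<exists>u. (\<forall>i\<in>I. 0 \<le> u i) \<and> sum u I = 1 \<and> (\<Sum>i\<in>I. u i *\<^sub>R v i) = 0)"
proof (cases "0 \<in> convex hull (v ` I)")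
  case False
  let ?C = "convex hull (v ` I)"
  have C: "closed ?C" "convex ?C" "?C \<noteq> {}"
    using I by (auto intro: compact_imp_closed compact_convex_hull finite_imp_compact)
  define d where "d = closest_point ?C 0"
  have "d \<in> ?C" unfolding d_def using C by (intro closest_point_in_set)
  moreover have "?C \<subseteq> V"
    using v V by (intro hull_minimal) (auto intro: subspace_imp_convex)
  ultimately have "d \<in> V" "d \<noteq> 0" using False by auto
  moreover have "0 < d \<bullet> v i" if "i \<in> I" for i
  proof -
    have "v i \<in> ?C" using that by (auto intro: hull_inc)
    then have "(0 - d) \<bullet> (v i - d) \<le> 0"
      unfolding d_def using C by (intro closest_point_dot)
    then have "d \<bullet> d \<le> d \<bullet> v i" by (simp add: inner_diff_right)
    moreover have "0 < d \<bullet> d" using \<open>d \<noteq> 0\<close> by simp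
    ultimately show ?thesis by linarith
  qed
  ultimately show ?thesis by blast
next
  case True
  \<comment> \<open>The vectors may coincide, so the weights of the hull are given to one index for each vector.\<close>
  obtain J where J: "J \<subseteq> I" "inj_on v J" "v ` J = v ` I"
    using subset_image_inj[of "v ` I" v I] by auto
  obtain w where w: "\<And>x. x \<in> v ` J \<Longrightarrow> 0 \<le> w x" "sum w (v ` J) = 1"
      "(\<Sum>x\<in>v ` J. w x *\<^sub>R x) = 0"
    using True I unfolding J(3)[symmetric]
    by (subst (asm) convex_hull_finite) (use J(1) I(1) in \<open>auto intro: finite_subset\<close>)
  define u where "u i = (if i \<in> J then w (v i) else 0)" for i
  have "sum u I = sum u J" "(\<Sum>i\<in>I. u i *\<^sub>R v i) = (\<Sum>i\<in>J. u i *\<^sub>R v i)"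
    using I J(1) by (intro sum.mono_neutral_right; auto simp: u_def)+
  then have "sum u I = 1" "(\<Sum>i\<in>I. u i *\<^sub>R v i) = 0"
    using w(2,3) J(2) by (simp_all add: sum.reindex u_def)
  moreover have "\<forall>i\<in>I. 0 \<le> u i"
    using w(1) by (simp add: u_def)
  ultimately show ?thesis by blast
qed

section \<open>The Karush-Kuhn-Tucker conditions for convex programs\<close>

definition KKT_multipliers ::
    "'i set \<Rightarrow> ('i \<Rightarrow> 'a::real_inner \<Rightarrow> real) \<Rightarrow> 'a \<Rightarrow> ('i \<Rightarrow> 'a) \<Rightarrow> 'a \<Rightarrow> ('i \<Rightarrow> real) \<Rightarrow> bool" where
  "KKT_multipliers A g D G z \<mu> \<longleftrightarrow>
     D + (\<Sum>j\<in>A. \<mu> j *\<^sub>R G j) = 0 \<and> (\<forall>j\<in>A. g j z \<le> 0) \<and> (\<forall>j\<in>A. \<mu> j \<ge> 0) \<and>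
     (\<Sum>j\<in>A. \<mu> j * g j z) = 0"

text \<open>
  Adding the tangent inequalities of the objective and of the constraints, weighted by the
  multipliers, cancels the gradients by stationarity. What remains is that the Lagrangian is
  minimal at \<open>z\<close>; it agrees with \<open>f\<close> there by complementarity and does not exceed \<open>f\<close> at feasible points.
\<close>

lemma KKT_sufficient:
  assumes V: "subspace V" "z \<in> V"
    and f: "convex_on V f" "has_gradient_in f D V z"
    and g: "\<And>j. j \<in> A \<Longrightarrow> convex_on V (g j)" "\<And>j. j \<in> A \<Longrightarrow> has_gradient_in (g j) (G j) V z"
    and KKT: "KKT_multipliers A g D G z \<mu>"
  shows "is_arg_min f (\<lambda>w. w \<in> V \<and> (\<forall>j\<in>A. g j w \<le> 0)) z"
proof -
  have "f z \<le> f w" if w: "w \<in> V" "\<forall>j\<in>A. g j w \<le> 0" for w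
  proof -
    have "\<mu> j * g j z + \<mu> j * ((w - z) \<bullet> G j) \<le> 0" if "j \<in> A" for j
    proof -
      have "g j z + (w - z) \<bullet> G j \<le> 0"
        using convex_on_above_tangent[OF V w(1) g(1,2)[OF that]] w(2) that by force
      then have "\<mu> j * (g j z + (w - z) \<bullet> G j) \<le> 0"
        using KKT that by (auto simp: KKT_multipliers_def mult_nonneg_nonpos)
      then show ?thesis by (simp add: algebra_simps)
    qed
    then have "(\<Sum>j\<in>A. \<mu> j * g j z + \<mu> j * ((w - z) \<bullet> G j)) \<le> 0"
      by (rule sum_nonpos)
    then have "(\<Sum>j\<in>A. \<mu> j * ((w - z) \<bullet> G j)) \<le> 0"
      using KKT by (simp add: sum.distrib KKT_multipliers_def)
    moreover have "(w - z) \<bullet> (D + (\<Sum>j\<in>A. \<mu> j *\<^sub>R G j)) = 0"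
      using KKT by (simp add: KKT_multipliers_def)
    then have "(w - z) \<bullet> D + (\<Sum>j\<in>A. \<mu> j * ((w - z) \<bullet> G j)) = 0"
      by (simp add: inner_add_right inner_sum_right)
    ultimately show ?thesis
      using convex_on_above_tangent[OF V w(1) f] by linarith
  qed
  then show ?thesis
    using V KKT by (force simp: is_arg_min_def KKT_multipliers_def)
qed

text \<open>
  A short step along a first-order descent direction for the objective and the active constraints
  would stay feasible, inactive constraints being preserved by continuity, and improve on the
  minimizer.
\<close>

lemma minimizer_no_descent_direction:
  assumes V: "subspace V" "z \<in> V" "d \<in> V" and A: "finite A"
    and f: "has_gradient_in f D V z"
    and g: "\<And>j. j \<in> A \<Longrightarrow> has_gradient_in (g j) (G j) V z"
    and min: "is_arg_min f (\<lambda>w. w \<in> V \<and> (\<forall>j\<in>A. g j w \<le> 0)) z"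
    and active: "\<And>j. j \<in> A \<Longrightarrow> g j z = 0 \<Longrightarrow> d \<bullet> G j < 0"
  shows "0 \<le> d \<bullet> D"
proof (rule ccontr)
  let ?z = "\<lambda>t::real. z + t *\<^sub>R d"
  have dec: "\<forall>\<^sub>F t in at_right 0. h (?z t) < h z"
    if "has_gradient_in h E V z" "d \<bullet> E < 0" for h E
    using DERIV_neg_dec_right[OF has_gradient_in_directional[OF V that(1)] that(2)]
    by (auto simp: eventually_at_right_field)
  assume "\<not> 0 \<le> d \<bullet> D"
  then have "\<forall>\<^sub>F t in at_right 0. f (?z t) < f z"
    using dec f by simp
  moreover have "\<forall>\<^sub>F t in at_right 0. g j (?z t) \<le> 0" if j: "j \<in> A" for j
  proof (cases "g j z = 0")
    case True
    then show ?thesis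
      using dec[OF g[OF j] active[OF j]] by (auto elim: eventually_mono)
  next
    case False
    then have neg: "g j z < 0"
      using min j by (force simp: is_arg_min_def)
    have "isCont (\<lambda>t. g j (?z t)) 0"
      using has_gradient_in_directional[OF V g[OF j]] by (rule DERIV_isCont)
    then have "((\<lambda>t. g j (?z t)) \<longlongrightarrow> g j z) (at_right 0)"
      by (auto simp: isCont_def intro: filterlim_mono at_le)
    from order_tendstoD(2)[OF this neg] show ?thesis
      by (auto elim: eventually_mono)
  qed
  then have "\<forall>\<^sub>F t in at_right 0. \<forall>j\<in>A. g j (?z t) \<le> 0"
    using A by (simp add: eventually_ball_finite)
  ultimately have "\<forall>\<^sub>F t in at_right 0. f (?z t) < f z \<and> (\<forall>j\<in>A. g j (?z t) \<le> 0)"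
    by (rule eventually_conj)
  then obtain t where "f (?z t) < f z" "\<forall>j\<in>A. g j (?z t) \<le> 0"
    using eventually_happens'[OF trivial_limit_at_right_real] by blast
  moreover have "?z t \<in> V"
    using V by (auto intro: subspace_add subspace_scale)
  ultimately show False
    using min by (auto simp: is_arg_min_def)
qed

text \<open>
  Without descent directions, a convex combination of the objective's gradient and the active
  constraints' gradients vanishes. Slater's condition keeps the objective's weight positive;
  dividing by that weight gives the multipliers, which are zero on the inactive constraints and so
  satisfy complementarity.
\<close>

lemma KKT_necessary:
  fixes f :: "'a::euclidean_space \<Rightarrow> real"
  assumes V: "subspace V" "z \<in> V" and A: "finite A"
    and f: "has_gradient_in f D V z"
    and g: "\<And>j. j \<in> A \<Longrightarrow> convex_on V (g j)" "\<And>j. j \<in> A \<Longrightarrow> has_gradient_in (g j) (G j) V z"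
    and slater: "s \<in> V" "\<And>j. j \<in> A \<Longrightarrow> g j s < 0"
    and min: "is_arg_min f (\<lambda>w. w \<in> V \<and> (\<forall>j\<in>A. g j w \<le> 0)) z"
  shows "\<exists>\<mu>. KKT_multipliers A g D G z \<mu>"
proof -
  define B where "B = {j \<in> A. g j z = 0}"
  have B: "finite B" "B \<subseteq> A" using A by (auto simp: B_def)
  \<comment> \<open>The objective's gradient is the vector of index \<open>None\<close>.\<close>
  define I where "I = insert None (Some ` B)"
  define v where "v = case_option D G"
  have sum_I: "sum h I = h None + (\<Sum>j\<in>B. h (Some j))" for h :: "_ \<Rightarrow> 'c::comm_monoid_add"
    using B by (simp add: I_def sum.reindex)
  have vV: "v i \<in> V" if "i \<in> I" for i
    using that f g(2) B by (auto simp: I_def v_def has_gradient_in_def)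
  have "\<not> (\<exists>d\<in>V. \<forall>i\<in>I. 0 < d \<bullet> v i)"
  proof
    assume "\<exists>d\<in>V. \<forall>i\<in>I. 0 < d \<bullet> v i"
    then obtain d where d: "d \<in> V" "0 < d \<bullet> D" "\<And>j. j \<in> B \<Longrightarrow> 0 < d \<bullet> G j"
      by (auto simp: I_def v_def)
    have "0 \<le> (- d) \<bullet> D"
      using V d by (intro minimizer_no_descent_direction[OF V _ A f g(2) min])
        (auto simp: B_def intro: subspace_neg)
    then show False using d by simp
  qed
  moreover have "finite I" "I \<noteq> {}" using B by (auto simp: I_def)
  ultimately obtain u where u: "\<And>i. i \<in> I \<Longrightarrow> 0 \<le> u i" "sum u I = 1" "(\<Sum>i\<in>I. u i *\<^sub>R v i) = 0"
    using gordan_alternative[of V I v] V(1) vV by blast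
  let ?u = "\<lambda>j. u (Some j)"
  have nonneg: "0 \<le> u None" "\<And>j. j \<in> B \<Longrightarrow> 0 \<le> ?u j"
    using u(1) by (auto simp: I_def)
  have comb: "u None *\<^sub>R D + (\<Sum>j\<in>B. ?u j *\<^sub>R G j) = 0"
    using u(3) by (simp add: sum_I v_def)
  \<comment> \<open>Otherwise the active constraints' gradients alone would cancel, but the direction towards \<open>s\<close>
    has a negative inner product with each of them.\<close>
  have "u None \<noteq> 0"
  proof
    assume zero: "u None = 0"
    have descent: "(s - z) \<bullet> G j < 0" if "j \<in> B" for j
      using convex_on_above_tangent[OF V slater(1) g(1,2), of j] slater(2)[of j] that
      by (auto simp: B_def)
    have "(s - z) \<bullet> (\<Sum>j\<in>B. ?u j *\<^sub>R G j) = 0"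
      using comb zero by simp
    then have total: "(\<Sum>j\<in>B. ?u j * - ((s - z) \<bullet> G j)) = 0"
      by (simp add: inner_sum_right sum_negf)
    have "?u j * - ((s - z) \<bullet> G j) = 0" if "j \<in> B" for j
      using total that B nonneg descent
      by (subst (asm) sum_nonneg_eq_0_iff) (auto simp: mult_nonneg_nonpos less_imp_le)
    then have "?u j = 0" if "j \<in> B" for j
      using descent that by force
    then show False
      using u(2) zero by (simp add: sum_I)
  qed
  then have pos: "0 < u None" using nonneg(1) by simp
  define \<mu> where "\<mu> j = (if j \<in> B then ?u j / u None else 0)" for j
  have "(\<Sum>j\<in>A. \<mu> j *\<^sub>R G j) = (\<Sum>j\<in>B. \<mu> j *\<^sub>R G j)"
    using A B by (intro sum.mono_neutral_right) (auto simp: \<mu>_def)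
  also have "\<dots> = inverse (u None) *\<^sub>R (\<Sum>j\<in>B. ?u j *\<^sub>R G j)"
    by (simp add: \<mu>_def scaleR_sum_right field_simps)
  finally have "D + (\<Sum>j\<in>A. \<mu> j *\<^sub>R G j) =
      inverse (u None) *\<^sub>R (u None *\<^sub>R D + (\<Sum>j\<in>B. ?u j *\<^sub>R G j))"
    using pos by (simp add: scaleR_add_right)
  then have "D + (\<Sum>j\<in>A. \<mu> j *\<^sub>R G j) = 0"
    using comb by simp
  moreover have "\<forall>j\<in>A. 0 \<le> \<mu> j"
    using nonneg by (simp add: \<mu>_def)
  moreover have "(\<Sum>j\<in>A. \<mu> j * g j z) = 0"
    by (auto intro!: sum.neutral simp: \<mu>_def B_def)
  ultimately have "KKT_multipliers A g D G z \<mu>"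
    using min by (simp add: KKT_multipliers_def is_arg_min_def)
  then show ?thesis by blast
qed

section \<open>The game and its complementarity reformulation\<close>

lemma MPCC_feasible_iff_KKT:
  "(x, y, \<mu>) \<in> MPCC_feasible X N p \<theta> g \<longleftrightarrow> x \<in> X \<and> y \<in> profiles N \<and>
     (\<forall>i. \<mu> i \<in> {1..p i} \<rightarrow>\<^sub>E UNIV \<and>
        KKT_multipliers {1..p i} (\<lambda>j. g i j x)
          (gradient (coord_space (N i)) (\<lambda>z. \<theta> i x (replace_decision y i z)) (y $ i))
          (\<lambda>j. gradient (coord_space (N i)) (g i j x) (y $ i)) (y $ i) (\<mu> i))"
  by (simp add: MPCC_feasible_def KKT_multipliers_def)

lemma KKT_multipliers_cong:
  assumes "\<And>j. j \<in> A \<Longrightarrow> \<mu> j = \<nu> j"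
  shows "KKT_multipliers A g D G z \<mu> \<longleftrightarrow> KKT_multipliers A g D G z \<nu>"
  using assms by (simp add: KKT_multipliers_def)

lemma NEP_iff_MPCC_feasible:
  fixes N :: "'f::finite \<Rightarrow> 'm::finite set" and x :: "'x::topological_space"
  assumes smooth: "\<And>i. smooth_objective N \<theta> i"
      "\<And>i j. j \<in> {1..p i} \<Longrightarrow> smooth_constraint N g i j"
    and convex: "\<And>i y. y \<in> profiles N \<Longrightarrow>
        convex_on (coord_space (N i)) (\<lambda>z. \<theta> i x (replace_decision y i z))"
      "\<And>i j. j \<in> {1..p i} \<Longrightarrow> convex_on (coord_space (N i)) (g i j x)"
    and slater: "\<And>i. slater N p g i x" and x: "x \<in> X"
  shows "y \<in> NEP N p \<theta> g x \<longleftrightarrow> (\<exists>\<mu>. (x, y, \<mu>) \<in> MPCC_feasible X N p \<theta> g)"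
proof (cases "y \<in> profiles N")
  case False
  then show ?thesis by (simp add: NEP_def MPCC_feasible_def)
next
  case y: True
  let ?V = "\<lambda>i. coord_space (N i)"
  let ?\<theta> = "\<lambda>i z. \<theta> i x (replace_decision y i z)"
  let ?KKT = "\<lambda>i. KKT_multipliers {1..p i} (\<lambda>j. g i j x) (gradient (?V i) (?\<theta> i) (y $ i))
    (\<lambda>j. gradient (?V i) (g i j x) (y $ i)) (y $ i)"
  have yi: "y $ i \<in> ?V i" for i
    using y by (simp add: profiles_def)
  have grad\<theta>: "has_gradient_in (?\<theta> i) (gradient (?V i) (?\<theta> i) (y $ i)) (?V i) (y $ i)" for i
    using smooth(1)[of i] y yi
    by (intro has_gradient_in_coord_space) (auto simp: smooth_objective_def differentiable_on_def)
  have gradg: "has_gradient_in (g i j x) (gradient (?V i) (g i j x) (y $ i)) (?V i) (y $ i)"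
    if "j \<in> {1..p i}" for i j
    using smooth(2)[OF that] yi
    by (intro has_gradient_in_coord_space) (auto simp: smooth_constraint_def differentiable_on_def)
  have "is_arg_min (?\<theta> i) (\<lambda>z. z \<in> feasible_set N p g i x) (y $ i) \<longleftrightarrow> (\<exists>\<mu>. ?KKT i \<mu>)" for i
  proof -
    obtain s where s: "s \<in> ?V i" "\<And>j. j \<in> {1..p i} \<Longrightarrow> g i j x s < 0"
      using slater[of i] by (auto simp: slater_def)
    let ?D = "gradient (?V i) (?\<theta> i) (y $ i)"
    let ?G = "\<lambda>j. gradient (?V i) (g i j x) (y $ i)"
    let ?min = "is_arg_min (?\<theta> i) (\<lambda>w. w \<in> ?V i \<and> (\<forall>j\<in>{1..p i}. g i j x w \<le> 0)) (y $ i)"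
    have "?min \<longleftrightarrow> (\<exists>\<mu>. ?KKT i \<mu>)"
    proof
      assume ?min
      then show "\<exists>\<mu>. ?KKT i \<mu>"
        using subspace_coord_space[of "N i"] yi[of i] grad\<theta>[of i] convex(2)[of _ i] gradg[of _ i] s
        by (intro KKT_necessary[where V = "?V i" and f = "?\<theta> i" and s = s])
          (assumption | rule finite_atLeastAtMost)+
    next
      assume "\<exists>\<mu>. ?KKT i \<mu>"
      then obtain \<mu> where "?KKT i \<mu>" ..
      then show ?min
        using subspace_coord_space[of "N i"] yi[of i] convex(1)[OF y, of i] grad\<theta>[of i]
          convex(2)[of _ i] gradg[of _ i]
        by (intro KKT_sufficient[where V = "?V i" and D = ?D and G = ?G and \<mu> = \<mu>])
    qed
    then show ?thesis by (simp add: feasible_set_def)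
  qed
  then have "y \<in> NEP N p \<theta> g x \<longleftrightarrow> (\<forall>i. \<exists>\<mu>. ?KKT i \<mu>)"
    using y by (simp add: NEP_def)
  also have "\<dots> \<longleftrightarrow> (\<forall>i. \<exists>\<mu>. \<mu> \<in> {1..p i} \<rightarrow>\<^sub>E UNIV \<and> ?KKT i \<mu>)"
  proof (rule all_cong1)
    fix i
    \<comment> \<open>The conditions only read multipliers with index in \<open>{1..p i}\<close>, so any others can be reset.\<close>
    have "?KKT i (restrict \<mu> {1..p i})" if "?KKT i \<mu>" for \<mu>
      using that by (subst KKT_multipliers_cong[where \<nu> = \<mu>]) simp_all
    moreover have "restrict \<mu> {1..p i} \<in> {1..p i} \<rightarrow>\<^sub>E UNIV" for \<mu> :: "nat \<Rightarrow> real"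
      by simp
    ultimately show "(\<exists>\<mu>. ?KKT i \<mu>) \<longleftrightarrow> (\<exists>\<mu>. \<mu> \<in> {1..p i} \<rightarrow>\<^sub>E UNIV \<and> ?KKT i \<mu>)"
      by blast
  qed
  also have "\<dots> \<longleftrightarrow> (\<exists>\<mu>. \<forall>i. \<mu> i \<in> {1..p i} \<rightarrow>\<^sub>E UNIV \<and> ?KKT i (\<mu> i))"
    by (rule choice_iff)
  finally show ?thesis
    using x y by (simp add: MPCC_feasible_iff_KKT)
qed

theorem theorem3:
  fixes X :: "(real ^ 'n) set"
    and N :: "'f::finite \<Rightarrow> 'm::finite set"
    and p :: "'f \<Rightarrow> nat"
    and \<theta>\<^sub>0 :: "real ^ 'n \<Rightarrow> real ^ 'm ^ 'f \<Rightarrow> real"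
    and \<theta> :: "'f \<Rightarrow> real ^ 'n \<Rightarrow> real ^ 'm ^ 'f \<Rightarrow> real"
    and g :: "'f \<Rightarrow> nat \<Rightarrow> real ^ 'n \<Rightarrow> real ^ 'm \<Rightarrow> real"
    and xbar :: "real ^ 'n" and ybar :: "real ^ 'm ^ 'f" and \<mu>bar :: "'f \<Rightarrow> nat \<Rightarrow> real"
  assumes "\<And>i. smooth_objective N \<theta> i"
    and "\<And>i j. j \<in> {1..p i} \<Longrightarrow> smooth_constraint N g i j"
    and "\<And>i x y. y \<in> profiles N \<Longrightarrow>
           convex_on (coord_space (N i)) (\<lambda>z. \<theta> i x (replace_decision y i z))"
    and "\<And>i j x. j \<in> {1..p i} \<Longrightarrow> convex_on (coord_space (N i)) (g i j x)"
    and "\<And>i x. x \<in> X \<Longrightarrow> slater N p g i x"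
    and "MPCC_global_solution \<theta>\<^sub>0 X N p \<theta> g xbar ybar \<mu>bar"
  shows "SLMFG_global_solution \<theta>\<^sub>0 X N p \<theta> g xbar ybar"
proof -
  have iff: "y \<in> NEP N p \<theta> g x \<longleftrightarrow> (\<exists>\<mu>. (x, y, \<mu>) \<in> MPCC_feasible X N p \<theta> g)" if "x \<in> X" for x y
    using assms(1-5) that by (intro NEP_iff_MPCC_feasible)
  have opt: "(xbar, ybar, \<mu>bar) \<in> MPCC_feasible X N p \<theta> g"
      "\<And>x y \<mu>. (x, y, \<mu>) \<in> MPCC_feasible X N p \<theta> g \<Longrightarrow> \<not> \<theta>\<^sub>0 x y < \<theta>\<^sub>0 xbar ybar"
    using assms(6) by (auto simp: MPCC_global_solution_def is_arg_min_def)
  then have "xbar \<in> X" by (simp add: MPCC_feasible_def)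
  with opt iff show ?thesis
    by (auto simp: SLMFG_global_solution_def is_arg_min_def SLMFG_feasible_def)
qed

end
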